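(* Let $X_1,\dots,X_n$ be an i.i.d. sample from a random variable $X$ with continuous distribution function $F_X$ and quantile function $q_X$, and let $X_{(1)}\le\cdots\le X_{(n)}$ be the order statistics. For each $i\in\{1,\dots,n\}$, the plotting position for $X_{(i)}$ obtained by minimizing the future-value probability loss, $$p_i=\underset{p\in[0,1]}{\mathrm{argmin}}\ \gamma_X(X_{(i)},q_X(p)),$$ is given by $p_i=\mathrm{Med}\{\mathrm{Beta}(i,n+1-i)\}$.
   Context: $\mathrm{Beta}(\alpha,\beta)$ is the distribution on $[0,1]$ with density $\frac{\Gamma(\alpha+\beta)}{\Gamma(\alpha)\Gamma(\beta)}x^{\alpha-1}(1-x)^{\beta-1}$, and $\mathrm{Med}$ denotes its median. The quantile function $q_X$ is the inverse of $F_X$; when $F_X$ is not strictly increasing it is understood as $q_X(p)=\inf\{x:F_X(x)\ge p\}$, with values in the extended reals and the conventions $F_X(-\infty)=0$, $F_X(+\infty)=1$. For functions of the data $D_1,D_2$ (constants allowed), the future-value probability loss is the non-random number $$\gamma_X(D_1,D_2):=P(D_1<X_f<D_2)+P(D_2<X_f<D_1),$$ where $X_f$ has the same distribution as $X$ and is independent of the sample $X_1,\dots,X_n$ (a new future draw); the probability is over both the sample and $X_f$. *)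

theory Defs
  imports "HOL-Probability.Probability"
begin

text \<open>
  Distributions of real random variables are Borel measures on the reals, e.g. the law
  \<open>distr N borel X\<close> of \<open>X\<close> on the probability space \<open>N\<close>.
\<close>

text \<open>The library's \<^const>\<open>cdf\<close>, with arguments extended to \<open>\<plusminus>\<infinity>\<close>.\<close>

definition ext_cdf :: "real measure \<Rightarrow> ereal \<Rightarrow> real" where
  "ext_cdf \<mu> x =
     (if x = -\<infinity> then 0 else if x = \<infinity> then 1 else cdf \<mu> (real_of_ereal x))"

text \<open>
  The infimum ranges over the extended reals, so the value at 0 is \<open>-\<infinity>\<close>, and the value
  at 1 is \<open>\<infinity>\<close> if the distribution function does not reach 1 on the reals.
\<close>

definition quantile :: "real measure \<Rightarrow> real \<Rightarrow> ereal" where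
  "quantile \<mu> p = Inf {x. p \<le> ext_cdf \<mu> x}"

definition is_median :: "real measure \<Rightarrow> real \<Rightarrow> bool" where
  "is_median \<mu> m \<longleftrightarrow> measure \<mu> {..m} \<ge> 1 / 2 \<and> measure \<mu> {m..} \<ge> 1 / 2"

text \<open>Meaningful only for distributions with exactly one median, such as Beta distributions.\<close>

definition median :: "real measure \<Rightarrow> real" where
  "median \<mu> = (THE m. is_median \<mu> m)"

definition beta_density :: "real \<Rightarrow> real \<Rightarrow> real \<Rightarrow> real" where
  "beta_density a b x =
     (if x \<in> {0..1}
      then Gamma (a + b) / (Gamma a * Gamma b) * x powr (a - 1) * (1 - x) powr (b - 1)
      else 0)"

definition beta_distribution :: "real \<Rightarrow> real \<Rightarrow> real measure" where
  "beta_distribution a b = density lborel (\<lambda>x. ennreal (beta_density a b x))"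

text \<open>The \<open>i\<close>-th smallest of \<open>X 1 \<omega>, \<dots>, X n \<omega>\<close>, counted with multiplicity, for \<open>1 \<le> i \<le> n\<close>.\<close>

definition order_statistic :: "nat \<Rightarrow> (nat \<Rightarrow> 'a \<Rightarrow> real) \<Rightarrow> nat \<Rightarrow> 'a \<Rightarrow> real" where
  "order_statistic n X i \<omega> = sort (map (\<lambda>j. X j \<omega>) [1..<n + 1]) ! (i - 1)"

text \<open>
  \<open>M\<close> carries both the sample and the future draw \<open>Xf\<close>; \<open>D1\<close> and \<open>D2\<close> are extended real
  because quantiles may be infinite.
\<close>

definition future_value_loss ::
    "'a measure \<Rightarrow> ('a \<Rightarrow> real) \<Rightarrow> ('a \<Rightarrow> ereal) \<Rightarrow> ('a \<Rightarrow> ereal) \<Rightarrow> real" where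
  "future_value_loss M Xf D1 D2 =
     measure M {\<omega> \<in> space M. D1 \<omega> < ereal (Xf \<omega>) \<and> ereal (Xf \<omega>) < D2 \<omega>} +
     measure M {\<omega> \<in> space M. D2 \<omega> < ereal (Xf \<omega>) \<and> ereal (Xf \<omega>) < D1 \<omega>}"

end

theory Submission
  imports Defs
begin

text \<open>
  Write \<open>F\<close> for the continuous distribution function, \<open>V = F (X\<^bsub>(i)\<^esub>)\<close> and \<open>U = F Xf\<close>. The loss only
  compares positions on the \<open>F\<close>-scale. Since \<open>F\<close> is monotone and continuous, \<open>F x < p\<close> forces
  \<open>x < q p\<close> and \<open>F x > p\<close> forces \<open>x > q p\<close>, so that \<open>q p\<close> acts like \<open>p\<close> except on the event
  \<open>U = p\<close>. In the same way \<open>X\<^bsub>(i)\<^esub> < Xf\<close> and \<open>V < U\<close> differ only on the event \<open>U = V\<close>. By the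
  probability integral transform \<open>U\<close> is uniform on \<open>{0..1}\<close>; it is independent of \<open>V\<close>, so both
  exceptional events are null and the loss is \<open>P (V < U < p) + P (p < U < V)\<close>.

  The law of \<open>V\<close> is \<open>Beta (i, n + 1 - i)\<close>: the event \<open>V \<le> u\<close> says that at least \<open>i\<close> of the \<open>n\<close>
  independent uniform variables \<open>F (X j)\<close> are at most \<open>u\<close>. Its probability is an upper tail of
  the binomial distribution, whose derivative in \<open>u\<close> telescopes to the Beta density.

  With \<open>G\<close> the distribution function of \<open>V\<close>, integrating over the value \<open>u\<close> of \<open>U\<close> turns the loss
  into \<open>\<integral>\<^sub>0\<^sup>p G u du + \<integral>\<^sub>p\<^sup>1 (1 - G u) du\<close>, with derivative \<open>2 G p - 1\<close> in \<open>p\<close>. As \<open>G\<close> increases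
  strictly from \<open>0\<close> to \<open>1\<close> on \<open>{0..1}\<close>, the loss strictly decreases up to the solution of
  \<open>G p = 1/2\<close> and strictly increases afterwards. That solution is the Beta median.
\<close>

section \<open>Quantiles and the probability integral transform\<close>

text \<open>
  The infimum defining the quantile is a strict bound on either side, because a strict inequality
  between \<open>cdf M x\<close> and \<open>p\<close> persists at points slightly beyond \<open>x\<close> (continuity from the right)
  and slightly before \<open>x\<close> (continuity from the left).
\<close>

lemma (in real_distribution) quantile_bounds:
  assumes "continuous_on UNIV (cdf M)"
  shows less_quantile: "cdf M x < p \<Longrightarrow> ereal x < quantile M p"
    and quantile_less: "p < cdf M x \<Longrightarrow> quantile M p < ereal x"
proof -
  have cont: "isCont (cdf M) x" for x
    using assms by (simp add: continuous_on_eq_continuous_at)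
  assume *: "cdf M x < p"
  have "eventually (\<lambda>z. cdf M z < p) (at_right x)"
    using cont[of x] * by (intro order_tendstoD(2)[where y = "cdf M x"])
      (auto simp: isCont_def filterlim_at_split)
  then obtain b where b: "b > x" "\<And>y. x < y \<Longrightarrow> y < b \<Longrightarrow> cdf M y < p"
    by (auto simp: eventually_at_right_field)
  define z where "z = (x + b) / 2"
  have z: "x < z" "cdf M z < p" using b by (auto simp: z_def)
  have "z \<le> r" if "p \<le> cdf M r" for r
    using z cdf_nondecreasing[of r z] that by linarith
  moreover have "0 < p" using z cdf_nonneg[of z] by linarith
  ultimately have "ereal z \<le> y" if "p \<le> ext_cdf M y" for y
    using that by (cases y) (auto simp: ext_cdf_def)
  then have "ereal z \<le> quantile M p"
    unfolding quantile_def by (intro Inf_greatest) simp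
  with z show "ereal x < quantile M p"
    by (meson less_ereal.simps(1) less_le_trans)
next
  have cont: "isCont (cdf M) x" for x
    using assms by (simp add: continuous_on_eq_continuous_at)
  assume *: "p < cdf M x"
  have "eventually (\<lambda>z. p < cdf M z) (at_left x)"
    using cont[of x] * by (intro order_tendstoD(1)[where y = "cdf M x"])
      (auto simp: isCont_def filterlim_at_split)
  then obtain b where b: "b < x" "\<And>y. b < y \<Longrightarrow> y < x \<Longrightarrow> p < cdf M y"
    by (auto simp: eventually_at_left_field)
  define z where "z = (x + b) / 2"
  have z: "z < x" "p < cdf M z" using b by (auto simp: z_def)
  have "quantile M p \<le> ereal z"
    unfolding quantile_def using z by (intro Inf_lower) (simp add: ext_cdf_def)
  with z show "quantile M p < ereal x"
    by (meson less_ereal.simps(1) le_less_trans)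
qed

text \<open>
  When \<open>u < 1\<close> and the sublevel set is not empty, it is a half-line whose endpoint \<open>s\<close> satisfies
  \<open>cdf M s = u\<close> by the intermediate value theorem. The half-line therefore has mass \<open>u\<close>, even if
  \<open>cdf M\<close> is constant to the left of \<open>s\<close>. Clamping to \<open>{0..1}\<close> covers the remaining \<open>u\<close>.
\<close>

lemma (in real_distribution) measure_cdf_sublevel:
  assumes cont: "continuous_on UNIV (cdf M)"
  shows "measure M {x. cdf M x \<le> u} = max 0 (min 1 u)"
proof (cases "u < 1")
  case False
  then have "{x. cdf M x \<le> u} = UNIV"
    using cdf_bounded_prob order_trans by (auto simp: not_less)
  then show ?thesis using False prob_space by simp
next
  case True
  let ?S = "{x. cdf M x \<le> u}"
  show ?thesis
  proof (cases "?S = {}")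
    case True
    have "u \<le> 0"
    proof (rule tendsto_lowerbound[OF cdf_lim_at_bot])
      show "eventually (\<lambda>x. u \<le> cdf M x) at_bot"
        using True by (intro always_eventually) (metis (mono_tags, lifting) empty_iff linorder_le_cases mem_Collect_eq)
    qed simp
    then show ?thesis using True by simp
  next
    case False
    obtain b where b: "u < cdf M b"
      using order_tendstoD(1)[OF cdf_lim_at_top_prob \<open>u < 1\<close>]
      by (auto simp: eventually_at_top_linorder)
    have bdd: "bdd_above ?S"
      using b cdf_nondecreasing by (intro bdd_aboveI[of _ b]) (metis mem_Collect_eq linorder_not_less nle_le order.trans)
    have "closed ?S"
      using cont by (intro closed_Collect_le continuous_intros) auto
    then have s: "Sup ?S \<in> ?S" using bdd False by (intro closed_contains_Sup)
    define s where "s = Sup ?S"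
    have S: "?S = {..s}"
      using s cdf_nondecreasing[of _ s] bdd by (auto simp: s_def intro: cSup_upper order_trans)
    have "s \<le> b" using s b cdf_nondecreasing[of b s] by (fastforce simp: s_def[symmetric])
    then obtain x where x: "s \<le> x" "cdf M x = u"
      using IVT'[of "cdf M" s u b] s b cont by (auto simp: s_def[symmetric] intro: continuous_on_subset)
    then have "x \<in> {..s}" unfolding S[symmetric] by simp
    then have "x = s" using x by simp
    then have "measure M ?S = u" using S x by (simp add: cdf_def)
    moreover have "0 \<le> u" using x cdf_nonneg by metis
    ultimately show ?thesis using \<open>u < 1\<close> by simp
  qed
qed

lemma cdf_uniform: "cdf (uniform_measure lborel {0..1}) u = max 0 (min 1 u)"
proof -
  have "{0..1} \<inter> {..u} = {0..min 1 u}" by auto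
  then show ?thesis by (auto simp: cdf_def)
qed

lemma real_distribution_uniform: "real_distribution (uniform_measure lborel {0..1})"
  by (simp add: real_distribution_def real_distribution_axioms_def prob_space_uniform_measure)

lemma (in real_distribution) probability_integral_transform:
  assumes cont: "continuous_on UNIV (cdf M)"
  shows "distr M borel (cdf M) = uniform_measure lborel {0..1}"
proof (rule cdf_unique[OF _ real_distribution_uniform])
  have meas: "cdf M \<in> borel_measurable M"
    using cont by (simp add: borel_measurable_continuous_onI)
  show "real_distribution (distr M borel (cdf M))"
    using meas by simp
  show "cdf (distr M borel (cdf M)) = cdf (uniform_measure lborel {0..1})"
  proof
    fix u
    have "cdf (distr M borel (cdf M)) u = measure M {x. cdf M x \<le> u}"
      using meas by (simp add: cdf_def[of "distr _ _ _"] measure_distr vimage_def)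
    then show "cdf (distr M borel (cdf M)) u = cdf (uniform_measure lborel {0..1}) u"
      by (simp add: measure_cdf_sublevel[OF cont] cdf_uniform)
  qed
qed

section \<open>Binomial tails and Beta distributions\<close>

definition binomial_tail :: "nat \<Rightarrow> nat \<Rightarrow> real \<Rightarrow> real" where
  "binomial_tail n i u = (\<Sum>k=i..n. real (n choose k) * u ^ k * (1 - u) ^ (n - k))"

text \<open>
  Write \<open>a k\<close> for the claimed derivative with \<open>k\<close> in place of \<open>i\<close>. The derivative of the
  \<open>k\<close>-th summand is \<open>a k - a (k + 1)\<close>, because
  \<open>(k + 1) (n choose (k + 1)) = (n - k) (n choose k)\<close>. The sum telescopes to \<open>a i\<close>, as the other end
  \<open>a (n + 1)\<close> contains the factor \<open>n choose (n + 1) = 0\<close>.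
\<close>

lemma DERIV_binomial_tail:
  assumes "1 \<le> i" "i \<le> n"
  shows "(binomial_tail n i has_real_derivative
           real i * real (n choose i) * u ^ (i - 1) * (1 - u) ^ (n - i)) (at u)"
proof -
  define a where "a k = real k * real (n choose k) * u ^ (k - 1) * (1 - u) ^ (n - k)" for k
  have summand: "((\<lambda>u. real (n choose k) * u ^ k * (1 - u) ^ (n - k))
      has_real_derivative (a k - a (Suc k))) (at u)" if "k \<in> {i..n}" for k
  proof -
    have "real (Suc k) * real (n choose Suc k) = real (n - k) * real (n choose k)"
      using binomial_absorb_comp[of n k] binomial_absorption[of k n]
      by (metis of_nat_mult binomial_absorb_comp binomial_absorption)
    then have "a (Suc k) = real (n - k) * real (n choose k) * u ^ k * (1 - u) ^ (n - Suc k)"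
      by (simp add: a_def)
    then show ?thesis
      by (auto intro!: derivative_eq_intros simp: a_def algebra_simps)
  qed
  have "(binomial_tail n i has_real_derivative (\<Sum>k=i..n. a k - a (Suc k))) (at u)"
    unfolding binomial_tail_def[abs_def] using summand by (intro DERIV_sum) auto
  also have "(\<Sum>k=i..n. a k - a (Suc k)) = a i - a (Suc n)"
    using sum_Suc_diff[of i n "\<lambda>k. - a k"] assms by (simp add: algebra_simps)
  finally show ?thesis by (simp add: a_def binomial_eq_0)
qed

lemma binomial_tail_0: "1 \<le> i \<Longrightarrow> binomial_tail n i 0 = 0"
  by (auto simp: binomial_tail_def intro!: sum.neutral)

lemma binomial_tail_1: "i \<le> n \<Longrightarrow> binomial_tail n i 1 = 1"
proof -
  assume "i \<le> n"
  have "binomial_tail n i 1 = (\<Sum>k=i..n. if k = n then 1 else 0)"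
    unfolding binomial_tail_def by (intro sum.cong) auto
  then show ?thesis using \<open>i \<le> n\<close> by simp
qed

lemma binomial_tail_strict_mono:
  assumes "1 \<le> i" "i \<le> n" "0 \<le> u" "u < v" "v \<le> 1"
  shows "binomial_tail n i u < binomial_tail n i v"
proof (rule DERIV_pos_imp_increasing_open[OF \<open>u < v\<close>])
  fix x assume "u < x" "x < v"
  then show "\<exists>y. (binomial_tail n i has_real_derivative y) (at x) \<and> 0 < y"
    using assms DERIV_binomial_tail[of i n x]
    by (intro exI[of _ "real i * real (n choose i) * x ^ (i - 1) * (1 - x) ^ (n - i)"]) auto
next
  show "continuous_on {u..v} (binomial_tail n i)"
    unfolding binomial_tail_def[abs_def] by (intro continuous_intros)
qed

text \<open>
  The endpoints are excluded: there \<open>0 powr 0 = 0\<close> differs from \<open>0 ^ 0 = 1\<close>.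
\<close>

lemma beta_density_nat:
  assumes "1 \<le> i" "i \<le> n" "0 < x" "x < 1"
  shows "beta_density (real i) (real n + 1 - real i) x
           = real i * real (n choose i) * x ^ (i - 1) * (1 - x) ^ (n - i)"
proof -
  have G: "Gamma (real n + 1) = fact n" "Gamma (real i) = fact (i - 1)"
      "Gamma (real n + 1 - real i) = fact (n - i)"
    using assms Gamma_fact[of n, where 'a = real] Gamma_fact[of "i - 1", where 'a = real]
      Gamma_fact[of "n - i", where 'a = real]
    by (simp_all add: of_nat_diff algebra_simps)
  have P: "x powr (real i - 1) = x ^ (i - 1)" "(1 - x) powr (real n - real i) = (1 - x) ^ (n - i)"
    using assms powr_realpow[of x "i - 1"] powr_realpow[of "1 - x" "n - i"]
    by (simp_all add: of_nat_diff)
  have "fact i = real i * fact (i - 1)"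
    using assms by (metis fact_reduce less_le_trans zero_less_one)
  then have "real i * real (n choose i) = fact n / (fact (i - 1) * fact (n - i))"
    using assms by (simp add: binomial_fact field_simps)
  then show ?thesis using assms G P by (simp add: beta_density_def)
qed

text \<open>
  Leaving the endpoints out of the condition on \<open>A\<close> lets one statement serve the half-lines
  \<open>{..u}\<close> for every real \<open>u\<close> and the whole line.
\<close>

lemma emeasure_beta_distribution:
  assumes i: "1 \<le> i" "i \<le> n" and c: "0 \<le> c" "c \<le> 1"
    and A: "A \<in> sets borel" "A \<inter> {0<..<1} = {0..c} \<inter> {0<..<1}"
  shows "emeasure (beta_distribution (real i) (real n + 1 - real i)) A = binomial_tail n i c"
proof -
  let ?d = "\<lambda>x::real. real i * real (n choose i) * x ^ (i - 1) * (1 - x) ^ (n - i)"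
  have [measurable]: "beta_density a b \<in> borel_measurable borel" for a b
    unfolding beta_density_def[abs_def] by measurable
  have "emeasure (beta_distribution (real i) (real n + 1 - real i)) A
      = (\<integral>\<^sup>+x. ennreal (beta_density (real i) (real n + 1 - real i) x) * indicator A x \<partial>lborel)"
    using A by (simp add: beta_distribution_def emeasure_density)
  also have "\<dots> = (\<integral>\<^sup>+x. ennreal (?d x) * indicator {0..c} x \<partial>lborel)"
  proof (rule nn_integral_cong_AE)
    have "AE x in lborel. x \<noteq> 0 \<and> x \<noteq> (1::real)"
      using AE_lborel_singleton[of "0::real"] AE_lborel_singleton[of "1::real"] by eventually_elim simp
    then show "AE x in lborel. ennreal (beta_density (real i) (real n + 1 - real i) x) * indicator A x
        = ennreal (?d x) * indicator {0..c} x"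
    proof eventually_elim
      case (elim x)
      show ?case
      proof (cases "0 < x \<and> x < 1")
        case True
        have "x \<in> A \<inter> {0<..<1} \<longleftrightarrow> x \<in> {0..c} \<inter> {0<..<1}" by (simp only: A(2))
        then have "x \<in> A \<longleftrightarrow> x \<in> {0..c}" using True by simp
        then show ?thesis using True i by (simp add: beta_density_nat indicator_def)
      next
        case False
        then show ?thesis using elim c by (auto simp: beta_density_def indicator_def)
      qed
    qed
  qed
  also have "\<dots> = binomial_tail n i c - binomial_tail n i 0"
    using i c
    by (intro nn_integral_FTC_Icc[where F = "binomial_tail n i"] DERIV_binomial_tail) auto
  finally show ?thesis using i by (simp add: binomial_tail_0)
qed

lemma
  assumes i: "1 \<le> i" "i \<le> n"
  shows real_distribution_beta:
      "real_distribution (beta_distribution (real i) (real n + 1 - real i))"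
    and cdf_beta: "cdf (beta_distribution (real i) (real n + 1 - real i)) u
                     = binomial_tail n i (max 0 (min 1 u))"
proof -
  let ?B = "beta_distribution (real i) (real n + 1 - real i)"
  have "emeasure ?B UNIV = binomial_tail n i 1"
    using i by (intro emeasure_beta_distribution) auto
  then show "real_distribution ?B"
    using i by (auto simp: real_distribution_def real_distribution_axioms_def beta_distribution_def
        binomial_tail_1 intro!: prob_spaceI)
  have "emeasure ?B {..u} = binomial_tail n i (max 0 (min 1 u))"
    using i by (intro emeasure_beta_distribution) auto
  moreover have "0 \<le> binomial_tail n i (max 0 (min 1 u))"
    by (auto simp: binomial_tail_def intro!: sum_nonneg mult_nonneg_nonneg)
  ultimately show "cdf ?B u = binomial_tail n i (max 0 (min 1 u))"
    by (simp add: cdf_def measure_def)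
qed

lemma continuous_cdf_beta:
  assumes i: "1 \<le> i" "i \<le> n"
  shows "continuous_on UNIV (cdf (beta_distribution (real i) (real n + 1 - real i)))"
  unfolding cdf_beta[OF i, abs_def] binomial_tail_def by (intro continuous_intros)

lemma cdf_beta_strict_mono:
  assumes i: "1 \<le> i" "i \<le> n" and uv: "0 \<le> u" "u < v" "v \<le> 1"
  defines "B \<equiv> beta_distribution (real i) (real n + 1 - real i)"
  shows "cdf B u < cdf B v"
  using binomial_tail_strict_mono[OF i uv] uv unfolding B_def cdf_beta[OF i] by simp

text \<open>
  Without an atom at \<open>m\<close> the two closed half-lines at \<open>m\<close> have masses adding up to \<open>1\<close>, so both
  can reach \<open>1/2\<close> only if both are equal to it.
\<close>

lemma (in real_distribution) is_median_iff_cdf: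
  assumes "continuous_on UNIV (cdf M)"
  shows "is_median M m \<longleftrightarrow> cdf M m = 1 / 2"
proof -
  have "isCont (cdf M) m" using assms by (simp add: continuous_on_eq_continuous_at)
  then have 0: "measure M {m} = 0" by (simp add: isCont_cdf)
  have "measure M {m..} = measure M {m<..} + measure M {m}"
    by (subst finite_measure_Union[symmetric]) (auto intro!: arg_cong[where f = "measure M"])
  moreover have "measure M {m<..} = 1 - cdf M m"
    using prob_compl[of "{..m}"] by (simp add: cdf_def Compl_eq_Diff_UNIV[symmetric])
  ultimately show ?thesis using 0 by (auto simp: is_median_def cdf_def)
qed

text \<open>
  The distribution function increases strictly from \<open>0\<close> to \<open>1\<close> on \<open>{0..1}\<close> and is constant
  outside, so it takes the value \<open>1/2\<close> exactly once. This uniqueness gives the definite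
  description in \<^const>\<open>median\<close> its value.
\<close>

lemma median_beta:
  assumes i: "1 \<le> i" "i \<le> n"
  defines "B \<equiv> beta_distribution (real i) (real n + 1 - real i)"
  shows "0 < median B" "median B < 1" "cdf B (median B) = 1 / 2"
proof -
  interpret real_distribution B unfolding B_def by (rule real_distribution_beta[OF i])
  have "\<exists>m\<ge>0. m \<le> 1 \<and> cdf B m = 1 / 2"
    using i continuous_cdf_beta[OF i]
    by (intro IVT') (auto simp: B_def cdf_beta binomial_tail_0 binomial_tail_1 intro: continuous_on_subset)
  then obtain m where m: "cdf B m = 1 / 2" by blast
  have bounds: "0 < x" "x < 1" if "cdf B x = 1 / 2" for x
  proof -
    show "0 < x"
      using that i binomial_tail_0[of i n] by (cases "x \<le> 0") (auto simp: B_def cdf_beta)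
    show "x < 1"
      using that i binomial_tail_1[of i n] by (cases "x \<ge> 1") (auto simp: B_def cdf_beta)
  qed
  have unique: "x = m" if "cdf B x = 1 / 2" for x
    using that m bounds[OF that] bounds[OF m]
      cdf_beta_strict_mono[OF i, of x m] cdf_beta_strict_mono[OF i, of m x]
    by (cases x m rule: linorder_cases) (auto simp: B_def)
  have median_iff: "is_median B x \<longleftrightarrow> cdf B x = 1 / 2" for x
    unfolding B_def by (intro real_distribution.is_median_iff_cdf real_distribution_beta continuous_cdf_beta i)
  have "median B = m"
    unfolding median_def median_iff by (intro the_equality) (rule m, rule unique)
  then show "0 < median B" "median B < 1" "cdf B (median B) = 1 / 2"
    using m bounds[OF m] by simp_all
qed

section \<open>Order statistics\<close>

text \<open>
  A downward closed predicate selects an initial segment of a sorted list.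
\<close>

lemma sorted_nth_iff_filter:
  assumes "sorted ys" "k < length ys" "\<And>x y. x \<le> y \<Longrightarrow> P y \<Longrightarrow> P x"
  shows "P (ys ! k) \<longleftrightarrow> k < length (filter P ys)"
  using assms(1,2)
proof (induction ys arbitrary: k)
  case (Cons y ys)
  show ?case
  proof (cases "P y")
    case True
    then show ?thesis using Cons by (cases k) auto
  next
    case False
    then have "\<not> P z" if "z \<in> set (y # ys)" for z
      using that Cons.prems(1) assms(3)[of y z] by auto
    then show ?thesis
      using nth_mem[OF Cons.prems(2)] by (auto simp: filter_empty_conv)
  qed
qed simp

lemma order_statistic_cong:
  assumes "\<And>j. j \<in> {1..n} \<Longrightarrow> X j \<omega> = Y j \<omega>'"
  shows "order_statistic n X i \<omega> = order_statistic n Y i \<omega>'"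
proof -
  have "map (\<lambda>j. X j \<omega>) [1..<n + 1] = map (\<lambda>j. Y j \<omega>') [1..<n + 1]"
    using assms by (intro map_cong) auto
  then show ?thesis by (simp only: order_statistic_def)
qed

text \<open>
  Stated for downward closed predicates, of which \<open>x \<le> a\<close> gives measurability and
  \<open>cdf \<mu> x \<le> u\<close> gives the law of the transformed order statistic.
\<close>

lemma order_statistic_iff_card:
  assumes i: "i \<in> {1..n}" and down: "\<And>x y. x \<le> y \<Longrightarrow> P y \<Longrightarrow> P x"
  shows "P (order_statistic n X i \<omega>) \<longleftrightarrow> i \<le> card {j\<in>{1..n}. P (X j \<omega>)}"
proof -
  let ?xs = "map (\<lambda>j. X j \<omega>) [1..<n + 1]"
  have "P (order_statistic n X i \<omega>) \<longleftrightarrow> i - 1 < length (filter P (sort ?xs))"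
    unfolding order_statistic_def using i down by (intro sorted_nth_iff_filter) auto
  also have "length (filter P (sort ?xs)) = length (filter P ?xs)"
    by (metis mset_filter mset_sort size_mset)
  also have "\<dots> = card (set (filter (\<lambda>j. P (X j \<omega>)) [1..<n + 1]))"
    by (subst distinct_card) (auto simp: filter_map o_def simp del: upt_Suc)
  also have "set (filter (\<lambda>j. P (X j \<omega>)) [1..<n + 1]) = {j\<in>{1..n}. P (X j \<omega>)}"
    by auto
  finally show ?thesis using i by auto
qed

text \<open>
  The order statistic as a function of the sample vector: this form exhibits it as measurable
  with respect to the \<open>\<sigma>\<close>-algebra generated by the sample, where the independence from the
  future draw is given.
\<close>

lemma measurable_order_statistic:
  assumes i: "i \<in> {1..n}"
  shows "order_statistic n (\<lambda>j v. v j) i \<in> borel_measurable (Pi\<^sub>M {1..n} (\<lambda>_. borel))"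
proof (rule borel_measurableI_le)
  fix a :: real
  let ?P = "Pi\<^sub>M {1..n} (\<lambda>_. borel :: real measure)"
  have eq: "real (card {j\<in>{1..n}. v j \<le> a}) = (\<Sum>j=1..n. indicator {..a} (v j))" for v :: "nat \<Rightarrow> real"
  proof -
    have "(\<Sum>j=1..n. indicator {..a} (v j) :: real) = (\<Sum>j\<in>{j\<in>{1..n}. v j \<le> a}. 1)"
      by (intro sum.mono_neutral_cong_right) (auto simp: indicator_def)
    then show ?thesis by simp
  qed
  have "order_statistic n (\<lambda>j v. v j) i v \<le> a \<longleftrightarrow> real i \<le> (\<Sum>j=1..n. indicator {..a} (v j))" for v
    using order_statistic_iff_card[OF i, of "\<lambda>x. x \<le> a" "\<lambda>j v. v j" v] order_trans
    unfolding eq[symmetric] of_nat_le_iff by blast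
  then have "{v \<in> space ?P. order_statistic n (\<lambda>j v. v j) i v \<le> a}
      = {v \<in> space ?P. real i \<le> (\<Sum>j=1..n. indicator {..a} (v j))}"
    by simp
  also have "\<dots> \<in> sets ?P" by measurable
  finally show "{v \<in> space ?P. order_statistic n (\<lambda>j v. v j) i v \<le> a} \<in> sets ?P" .
qed

text \<open>
  The event splits according to the exact set \<open>S\<close> of indices that succeed. By independence each
  such piece has a probability depending only on \<open>card S\<close>, and \<open>n choose k\<close> sets have size \<open>k\<close>.
\<close>

lemma (in prob_space) prob_at_least_successes:
  assumes indep: "indep_vars (\<lambda>_. N) X {1..n}" and A: "A \<in> sets N"
    and u: "\<And>j. j \<in> {1..n} \<Longrightarrow> prob (X j -` A \<inter> space M) = u" and n: "1 \<le> n"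
  shows "prob {\<omega> \<in> space M. i \<le> card {j\<in>{1..n}. X j \<omega> \<in> A}} = binomial_tail n i u"
proof -
  have rv: "X j \<in> measurable M N" if "j \<in> {1..n}" for j
    using indep that by (auto simp: indep_vars_def)
  \<comment> \<open>\<open>E S\<close>: the successes are exactly the indices in \<open>S\<close>. It asks \<open>X j\<close> to lie in \<open>B S j\<close> for
    every \<open>j\<close>, so it is an intersection of independent events.\<close>
  define E where "E S = {\<omega> \<in> space M. {j\<in>{1..n}. X j \<omega> \<in> A} = S}" for S
  define B where "B S j = (if j \<in> S then A else space N - A)" for S :: "nat set" and j
  have E_eq: "E S = (\<Inter>j\<in>{1..n}. X j -` B S j \<inter> space M)" if "S \<subseteq> {1..n}" for S
  proof -
    have "\<omega> \<in> E S \<longleftrightarrow> (\<forall>j\<in>{1..n}. X j \<omega> \<in> B S j)" if "\<omega> \<in> space M" for \<omega>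
      using measurable_space[OF rv \<open>\<omega> \<in> space M\<close>] that \<open>S \<subseteq> {1..n}\<close>
      unfolding E_def B_def by (auto split: if_splits)
    then show ?thesis using n by (auto simp: E_def)
  qed
  have B: "B S j \<in> sets N" for S j using A by (auto simp: B_def)
  have E_sets: "E S \<in> events" if "S \<subseteq> {1..n}" for S
    using n B rv that by (auto simp: E_eq intro!: sets.finite_INT measurable_sets)
  have prob_E: "prob (E S) = u ^ card S * (1 - u) ^ (n - card S)" if S: "S \<subseteq> {1..n}" for S
  proof -
    have pB: "prob (X j -` B S j \<inter> space M) = (if j \<in> S then u else 1 - u)" if j: "j \<in> {1..n}" for j
    proof -
      have "X j -` (space N - A) \<inter> space M = space M - (X j -` A \<inter> space M)"
        using measurable_space[OF rv[OF j]] by auto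
      then show ?thesis
        using u[OF j] prob_compl[OF measurable_sets[OF rv[OF j] A]] by (auto simp: B_def)
    qed
    have "prob (E S) = (\<Prod>j\<in>{1..n}. prob (X j -` B S j \<inter> space M))"
      unfolding E_eq[OF S] using indep n B by (intro indep_varsD_finite) auto
    also have "\<dots> = (\<Prod>j\<in>{1..n}. if j \<in> S then u else 1 - u)"
      by (intro prod.cong refl pB)
    also have "\<dots> = u ^ card S * (1 - u) ^ card ({1..n} - S)"
      using S by (simp add: prod.If_cases Int_absorb1 Diff_eq)
    also have "card ({1..n} - S) = n - card S"
      using S by (simp add: card_Diff_subset finite_subset)
    finally show ?thesis .
  qed
  let ?I = "{S. S \<subseteq> {1..n} \<and> i \<le> card S}"
  have card_le: "card S \<le> n" if "S \<subseteq> {1..n}" for S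
    using card_mono[OF _ that] by simp
  have "{\<omega> \<in> space M. i \<le> card {j\<in>{1..n}. X j \<omega> \<in> A}} = (\<Union>S\<in>?I. E S)"
    by (auto simp: E_def)
  also have "prob \<dots> = (\<Sum>S\<in>?I. prob (E S))"
    using E_sets by (intro finite_measure_finite_Union) (auto simp: disjoint_family_on_def E_def)
  also have "\<dots> = (\<Sum>S\<in>?I. u ^ card S * (1 - u) ^ (n - card S))"
    by (intro sum.cong refl prob_E) auto
  also have "\<dots> = (\<Sum>k=i..n. \<Sum>S\<in>{S\<in>?I. card S = k}. u ^ card S * (1 - u) ^ (n - card S))"
    using card_le by (intro sum.group[symmetric]) auto
  also have "\<dots> = binomial_tail n i u"
    unfolding binomial_tail_def
  proof (intro sum.cong refl)
    fix k assume k: "k \<in> {i..n}"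
    then have "{S\<in>?I. card S = k} = {S. S \<subseteq> {1..n} \<and> card S = k}" by auto
    then show "(\<Sum>S\<in>{S\<in>?I. card S = k}. u ^ card S * (1 - u) ^ (n - card S))
        = real (n choose k) * u ^ k * (1 - u) ^ (n - k)"
      using n_subsets[of "{1..n}" k] by simp
  qed
  finally show ?thesis .
qed

text \<open>
  Monotonicity of \<open>cdf \<mu>\<close> makes \<open>cdf \<mu> x \<le> u\<close> downward closed in \<open>x\<close>. Hence the transformed order
  statistic is at most \<open>u\<close> iff at least \<open>i\<close> sample points fall into this sublevel set, whose mass
  is \<open>u\<close> clamped to \<open>{0..1}\<close>; the Beta distribution function is the same binomial tail.
\<close>

lemma (in prob_space) distr_cdf_order_statistic:
  assumes mu: "real_distribution \<mu>" and cont: "continuous_on UNIV (cdf \<mu>)"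
    and indep: "indep_vars (\<lambda>_. borel) X {1..n}"
    and law: "\<And>j. j \<in> {1..n} \<Longrightarrow> distr M borel (X j) = \<mu>"
    and i: "i \<in> {1..n}"
    and meas: "order_statistic n X i \<in> borel_measurable M"
  shows "distr M borel (\<lambda>\<omega>. cdf \<mu> (order_statistic n X i \<omega>))
           = beta_distribution (real i) (real n + 1 - real i)"
proof (rule cdf_unique)
  interpret \<mu>: real_distribution \<mu> by (rule mu)
  have [measurable]: "cdf \<mu> \<in> borel_measurable borel"
    using cont by (rule borel_measurable_continuous_onI)
  note [measurable] = meas
  show "real_distribution (distr M borel (\<lambda>\<omega>. cdf \<mu> (order_statistic n X i \<omega>)))"
    by simp
  show "real_distribution (beta_distribution (real i) (real n + 1 - real i))"
    using i by (intro real_distribution_beta) auto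
  show "cdf (distr M borel (\<lambda>\<omega>. cdf \<mu> (order_statistic n X i \<omega>)))
      = cdf (beta_distribution (real i) (real n + 1 - real i))"
  proof
    fix u
    let ?A = "{x. cdf \<mu> x \<le> u}"
    have A: "?A \<in> sets borel" by measurable
    have "prob (X j -` ?A \<inter> space M) = max 0 (min 1 u)" if j: "j \<in> {1..n}" for j
    proof -
      have "X j \<in> borel_measurable M" using indep j by (auto simp: indep_vars_def)
      then have "prob (X j -` ?A \<inter> space M) = measure (distr M borel (X j)) ?A"
        using A by (simp add: measure_distr)
      then show ?thesis using \<mu>.measure_cdf_sublevel[OF cont] law[OF j] by simp
    qed
    then have *: "prob {\<omega> \<in> space M. i \<le> card {j\<in>{1..n}. X j \<omega> \<in> ?A}} = binomial_tail n i (max 0 (min 1 u))"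
      using indep A i by (intro prob_at_least_successes) auto
    have "cdf (distr M borel (\<lambda>\<omega>. cdf \<mu> (order_statistic n X i \<omega>))) u
        = prob {\<omega> \<in> space M. order_statistic n X i \<omega> \<in> ?A}"
      by (auto simp: cdf_def[of "distr _ _ _"] measure_distr intro!: arg_cong[where f = prob])
    also have "\<dots> = prob {\<omega> \<in> space M. i \<le> card {j\<in>{1..n}. X j \<omega> \<in> ?A}}"
      using order_statistic_iff_card[OF i, of "\<lambda>x. x \<in> ?A"] \<mu>.cdf_nondecreasing order_trans
      by (metis (mono_tags, lifting) mem_Collect_eq)
    finally show "cdf (distr M borel (\<lambda>\<omega>. cdf \<mu> (order_statistic n X i \<omega>))) u
        = cdf (beta_distribution (real i) (real n + 1 - real i)) u"
      using * i by (simp add: cdf_beta)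
  qed
qed

section \<open>Comparison with an independent uniform variable\<close>

text \<open>
  Independence of \<open>\<sigma>\<close>-algebras passes to variables measurable in them. This detour serves the
  sample vector and the future draw, whose value types differ: \<^const>\<open>prob_space.indep_var\<close>
  relates only variables of a common value type.
\<close>

lemma (in prob_space) indep_var_subalgebras:
  assumes indep: "indep_set (sets F) (sets G)"
    and space: "space F = space M" "space G = space M"
    and V: "V \<in> measurable F S" and U: "U \<in> measurable G T"
  shows "indep_var S V T U"
proof -
  have sub: "sets F \<subseteq> events" "sets G \<subseteq> events"
    using indep unfolding indep_sets2_eq by blast+
  have "random_variable S V"
    using measurable_space[OF V] measurable_sets[OF V] sub(1) unfolding space(1)
    by (intro measurableI) blast+
  moreover have "random_variable T U"
    using measurable_space[OF U] measurable_sets[OF U] sub(2) unfolding space(2)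
    by (intro measurableI) blast+
  moreover have "sigma_sets (space M) {V -` A \<inter> space M |A. A \<in> sets S} \<subseteq> sets F"
    unfolding space(1)[symmetric] using measurable_sets[OF V] by (intro sets.sigma_sets_subset) auto
  moreover have "sigma_sets (space M) {U -` A \<inter> space M |A. A \<in> sets T} \<subseteq> sets G"
    unfolding space(2)[symmetric] using measurable_sets[OF U] by (intro sets.sigma_sets_subset) auto
  ultimately show ?thesis
    using indep unfolding indep_var_eq indep_sets2_eq by (meson order_trans subsetD)
qed

text \<open>
  Fubini for the product law of \<open>(V, U)\<close>, with \<open>V\<close> integrated first.
\<close>

lemma (in prob_space) emeasure_indep_uniform:
  assumes indep: "indep_var borel V borel U"
    and unif: "distr M borel U = uniform_measure lborel {0..1::real}"
    and [measurable]: "Measurable.pred (borel \<Otimes>\<^sub>M borel) (\<lambda>x. R (fst x) (snd x))"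
  shows "emeasure M {\<omega> \<in> space M. R (V \<omega>) (U \<omega>)}
           = (\<integral>\<^sup>+u. emeasure (distr M borel V) {v. R v u} * indicator {0..1} u \<partial>lborel)"
proof -
  let ?Q = "{x \<in> space (borel \<Otimes>\<^sub>M borel). R (fst x) (snd x)}"
  have Q: "?Q \<in> sets (borel \<Otimes>\<^sub>M borel)" by measurable
  note [measurable] = indep_var_rv1[OF indep] indep_var_rv2[OF indep]
  interpret V: prob_space "distr M borel V" by (rule prob_space_distr) simp
  interpret U: prob_space "distr M borel U" by (rule prob_space_distr) simp
  interpret pair_sigma_finite "distr M borel V" "distr M borel U" ..
  have Q': "?Q \<in> sets (distr M borel V \<Otimes>\<^sub>M distr M borel U)"
    using Q by (simp cong: sets_pair_measure_cong)
  have "emeasure M {\<omega> \<in> space M. R (V \<omega>) (U \<omega>)}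
      = emeasure (distr M (borel \<Otimes>\<^sub>M borel) (\<lambda>\<omega>. (V \<omega>, U \<omega>))) ?Q"
    using Q by (subst emeasure_distr) (auto simp: space_pair_measure intro!: arg_cong[where f = "emeasure M"])
  also have "\<dots> = emeasure (distr M borel V \<Otimes>\<^sub>M distr M borel U) ?Q"
    using indep by (simp add: indep_var_distribution_eq)
  also have "\<dots> = (\<integral>\<^sup>+u. emeasure (distr M borel V) ((\<lambda>v. (v, u)) -` ?Q) \<partial>distr M borel U)"
    using Q' by (rule emeasure_pair_measure_alt2)
  also have "\<dots> = (\<integral>\<^sup>+u. emeasure (distr M borel V) {v. R v u} * indicator {0..1} u \<partial>lborel)"
    unfolding unif using measurable_emeasure_Pair2[OF Q']
    by (subst nn_integral_uniform_measure)
      (auto simp: vimage_def space_pair_measure unif divide_ennreal_def cong: measurable_cong_sets)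
  finally show ?thesis .
qed

text \<open>
  For fixed \<open>u \<noteq> p\<close> the section of the exceptional event is \<open>{u}\<close>, which is null because the
  law of \<open>V\<close> has no atoms.
\<close>

lemma (in prob_space) AE_indep_uniform_neq:
  assumes indep: "indep_var borel V borel U"
    and unif: "distr M borel U = uniform_measure lborel {0..1::real}"
    and cont: "continuous_on UNIV (cdf (distr M borel V))"
  shows "AE \<omega> in M. U \<omega> \<noteq> V \<omega> \<and> U \<omega> \<noteq> p"
proof -
  let ?B = "distr M borel V"
  note [measurable] = indep_var_rv1[OF indep] indep_var_rv2[OF indep]
  interpret B: real_distribution ?B by simp
  have 0: "measure ?B {u} = 0" for u
    using cont B.isCont_cdf by (simp add: continuous_on_eq_continuous_at)
  have AEp: "AE u in lborel. u \<noteq> p" by (rule AE_lborel_singleton)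
  have "emeasure M {\<omega> \<in> space M. U \<omega> = V \<omega> \<or> U \<omega> = p}
      = (\<integral>\<^sup>+u. emeasure ?B {v. u = v \<or> u = p} * indicator {0..1} u \<partial>lborel)"
    by (intro emeasure_indep_uniform indep unif) measurable
  also have "\<dots> = (\<integral>\<^sup>+u. 0 \<partial>(lborel :: real measure))"
    using AEp by (intro nn_integral_cong_AE, elim eventually_mono)
      (auto simp: B.emeasure_eq_measure 0)
  finally have "emeasure M {\<omega> \<in> space M. U \<omega> = V \<omega> \<or> U \<omega> = p} = 0" by simp
  then show "AE \<omega> in M. U \<omega> \<noteq> V \<omega> \<and> U \<omega> \<noteq> p"
    by (intro AE_I[where N = "{\<omega> \<in> space M. U \<omega> = V \<omega> \<or> U \<omega> = p}"]) auto
qed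

text \<open>
  Given \<open>U = u\<close>, the variable \<open>V\<close> lies below \<open>u\<close> with probability \<open>G u\<close> and above it with
  probability \<open>1 - G u\<close>, where \<open>G\<close> is the distribution function of \<open>V\<close>. Integrating over \<open>{0..p}\<close>
  and \<open>{p..1}\<close> respectively gives differences of the antiderivatives \<open>H\<close> of \<open>G\<close> and \<open>x - H x\<close>
  of \<open>1 - G\<close>.
\<close>

lemma (in prob_space)
  assumes indep: "indep_var borel V borel U"
    and unif: "distr M borel U = uniform_measure lborel {0..1::real}"
    and cont: "continuous_on UNIV (cdf (distr M borel V))"
    and H: "\<And>u. u \<in> {0..1} \<Longrightarrow> (H has_real_derivative cdf (distr M borel V) u) (at u)"
    and p: "p \<in> {0..1}"
  shows prob_between_left: "prob {\<omega> \<in> space M. V \<omega> < U \<omega> \<and> U \<omega> < p} = H p - H 0"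
    and prob_between_right: "prob {\<omega> \<in> space M. p < U \<omega> \<and> U \<omega> < V \<omega>} = (1 - H 1) - (p - H p)"
proof -
  let ?B = "distr M borel V"
  note [measurable] = indep_var_rv1[OF indep] indep_var_rv2[OF indep]
  interpret B: real_distribution ?B by simp
  let ?G = "cdf ?B"
  have [measurable]: "?G \<in> borel_measurable borel"
    using cont by (rule borel_measurable_continuous_onI)
  have 0: "measure ?B {u} = 0" for u
    using cont B.isCont_cdf by (simp add: continuous_on_eq_continuous_at)
  have "measure ?B {..u} = measure ?B {..<u} + measure ?B {u}" for u
    by (subst B.finite_measure_Union[symmetric]) (auto intro!: arg_cong[where f = "measure ?B"])
  then have less: "measure ?B {..<u} = ?G u" for u by (simp add: cdf_def 0)
  have greater: "measure ?B {u<..} = 1 - ?G u" for u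
    using B.prob_compl[of "{..u}"] by (simp add: cdf_def Compl_eq_Diff_UNIV[symmetric])

  have H': "((\<lambda>x. x - H x) has_real_derivative (1 - ?G x)) (at x)" if "x \<in> {0..1}" for x
    using that by (intro derivative_intros H)
  have AEp: "AE u in lborel. u \<noteq> p" by (rule AE_lborel_singleton)
  have "emeasure M {\<omega> \<in> space M. V \<omega> < U \<omega> \<and> U \<omega> < p}
      = (\<integral>\<^sup>+u. emeasure ?B {v. v < u \<and> u < p} * indicator {0..1} u \<partial>lborel)"
    by (intro emeasure_indep_uniform indep unif) measurable
  also have "\<dots> = (\<integral>\<^sup>+u. ennreal (?G u) * indicator {0..p} u \<partial>lborel)"
    using AEp p less by (intro nn_integral_cong_AE, elim eventually_mono)
      (auto simp: B.emeasure_eq_measure indicator_def lessThan_def)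
  also have "\<dots> = H p - H 0"
    using p H by (intro nn_integral_FTC_Icc[where F = H]) (auto simp: B.cdf_nonneg)
  finally have *: "emeasure M {\<omega> \<in> space M. V \<omega> < U \<omega> \<and> U \<omega> < p} = H p - H 0" by simp
  have "H 0 \<le> H p"
    using p H B.cdf_nonneg by (intro DERIV_nonneg_imp_nondecreasing[of 0 p H]) fastforce+
  with * show "prob {\<omega> \<in> space M. V \<omega> < U \<omega> \<and> U \<omega> < p} = H p - H 0" by (simp add: measure_def)

  have "emeasure M {\<omega> \<in> space M. p < U \<omega> \<and> U \<omega> < V \<omega>}
      = (\<integral>\<^sup>+u. emeasure ?B {v. p < u \<and> u < v} * indicator {0..1} u \<partial>lborel)"
    by (intro emeasure_indep_uniform indep unif) measurable
  also have "\<dots> = (\<integral>\<^sup>+u. ennreal (1 - ?G u) * indicator {p..1} u \<partial>lborel)"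
    using AEp p greater by (intro nn_integral_cong_AE, elim eventually_mono)
      (auto simp: B.emeasure_eq_measure indicator_def greaterThan_def)
  also have "\<dots> = (1 - H 1) - (p - H p)"
    using p B.cdf_bounded_prob by (intro nn_integral_FTC_Icc[where F = "\<lambda>x. x - H x"] H') auto
  finally have *: "emeasure M {\<omega> \<in> space M. p < U \<omega> \<and> U \<omega> < V \<omega>} = (1 - H 1) - (p - H p)" by simp
  have "p - H p \<le> 1 - H 1"
  proof (rule DERIV_nonneg_imp_nondecreasing[of p 1 "\<lambda>x. x - H x"])
    fix x assume "p \<le> x" "x \<le> 1"
    then have "((\<lambda>x. x - H x) has_real_derivative (1 - ?G x)) (at x)"
      using p by (intro H') auto
    then show "\<exists>y. ((\<lambda>x. x - H x) has_real_derivative y) (at x) \<and> 0 \<le> y"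
      using B.cdf_bounded_prob[of x] by (intro exI[of _ "1 - ?G x"]) simp
  qed (use p in simp)
  with * show "prob {\<omega> \<in> space M. p < U \<omega> \<and> U \<omega> < V \<omega>} = (1 - H 1) - (p - H p)"
    by (simp add: measure_def)
qed

section \<open>The optimal plotting position\<close>

text \<open>
  Away from ties, \<open>cdf \<mu>\<close> preserves and reflects the order between \<open>T\<close> and \<open>Y\<close>, and comparing
  \<open>Y\<close> with the \<open>p\<close>-quantile is comparing \<open>cdf \<mu> Y\<close> with \<open>p\<close>. Working almost everywhere also
  covers infinite quantiles and intervals where \<open>cdf \<mu>\<close> is constant.
\<close>

lemma (in prob_space) future_value_loss_eq_uniform:
  assumes mu: "real_distribution \<mu>" and cont: "continuous_on UNIV (cdf \<mu>)"
    and [measurable]: "Y \<in> borel_measurable M" "T \<in> borel_measurable M"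
    and AE: "AE \<omega> in M. cdf \<mu> (Y \<omega>) \<noteq> cdf \<mu> (T \<omega>) \<and> cdf \<mu> (Y \<omega>) \<noteq> p"
  shows "future_value_loss M Y (\<lambda>\<omega>. ereal (T \<omega>)) (\<lambda>\<omega>. quantile \<mu> p)
     = prob {\<omega> \<in> space M. cdf \<mu> (T \<omega>) < cdf \<mu> (Y \<omega>) \<and> cdf \<mu> (Y \<omega>) < p}
     + prob {\<omega> \<in> space M. p < cdf \<mu> (Y \<omega>) \<and> cdf \<mu> (Y \<omega>) < cdf \<mu> (T \<omega>)}"
proof -
  interpret \<mu>: real_distribution \<mu> by (rule mu)
  have [measurable]: "cdf \<mu> \<in> borel_measurable borel"
    using cont by (rule borel_measurable_continuous_onI)
  have less_iff: "x < y \<longleftrightarrow> cdf \<mu> x < cdf \<mu> y" if "cdf \<mu> x \<noteq> cdf \<mu> y" for x y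
    using that \<mu>.cdf_nondecreasing[of x y] \<mu>.cdf_nondecreasing[of y x] by linarith
  have quant_iff: "ereal x < quantile \<mu> p \<longleftrightarrow> cdf \<mu> x < p" "quantile \<mu> p < ereal x \<longleftrightarrow> p < cdf \<mu> x"
    if "cdf \<mu> x \<noteq> p" for x
    using that \<mu>.less_quantile[OF cont, of x p] \<mu>.quantile_less[OF cont, of p x]
    by (meson linorder_neqE_linordered_idom not_less_iff_gr_or_eq)+
  show ?thesis
    unfolding future_value_loss_def
  proof (intro arg_cong2[where f = "(+)"] finite_measure_eq_AE)
    show "AE \<omega> in M. \<omega> \<in> {\<omega> \<in> space M. ereal (T \<omega>) < ereal (Y \<omega>) \<and> ereal (Y \<omega>) < quantile \<mu> p} \<longleftrightarrow>
        \<omega> \<in> {\<omega> \<in> space M. cdf \<mu> (T \<omega>) < cdf \<mu> (Y \<omega>) \<and> cdf \<mu> (Y \<omega>) < p}"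
      using AE by eventually_elim (simp add: less_iff quant_iff)
    show "AE \<omega> in M. \<omega> \<in> {\<omega> \<in> space M. quantile \<mu> p < ereal (Y \<omega>) \<and> ereal (Y \<omega>) < ereal (T \<omega>)} \<longleftrightarrow>
        \<omega> \<in> {\<omega> \<in> space M. p < cdf \<mu> (Y \<omega>) \<and> cdf \<mu> (Y \<omega>) < cdf \<mu> (T \<omega>)}"
      using AE by eventually_elim (simp add: less_iff[of "Y _"] quant_iff)
  qed measurable
qed

theorem theorem2p2:
  fixes N :: "'b measure" and X :: "'b \<Rightarrow> real"
    and M :: "'a measure" and Xs :: "nat \<Rightarrow> 'a \<Rightarrow> real" and Xf :: "'a \<Rightarrow> real"
    and n i :: nat
  assumes "prob_space N" and "X \<in> borel_measurable N"
    and "continuous_on UNIV (cdf (distr N borel X))"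
    and "prob_space M"
    and "prob_space.indep_vars M (\<lambda>_. borel) Xs {1..n}"
    and "\<And>j. j \<in> {1..n} \<Longrightarrow> distr M borel (Xs j) = distr N borel X"
    and "Xf \<in> borel_measurable M"
    and "prob_space.indep_set M
           (sets (vimage_algebra (space M) (\<lambda>\<omega>. \<lambda>j\<in>{1..n}. Xs j \<omega>) (Pi\<^sub>M {1..n} (\<lambda>_. borel))))
           (sets (vimage_algebra (space M) Xf borel))"
    and "distr M borel Xf = distr N borel X"
    and "i \<in> {1..n}"
  shows "{p. is_arg_min
               (\<lambda>p. future_value_loss M Xf
                      (\<lambda>\<omega>. ereal (order_statistic n Xs i \<omega>))
                      (\<lambda>\<omega>. quantile (distr N borel X) p))
               (\<lambda>p. p \<in> {0..1}) p}
         = {median (beta_distribution (real i) (real n + 1 - real i))}"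
proof -
  interpret prob_space M by fact
  interpret N: prob_space N by fact
  define \<mu> where "\<mu> = distr N borel X"
  define B where "B = beta_distribution (real i) (real n + 1 - real i)"
  define T where "T = order_statistic n Xs i"
  have i: "1 \<le> i" "i \<le> n" using assms(10) by auto
  interpret \<mu>: real_distribution \<mu> unfolding \<mu>_def using assms(2) by simp
  interpret B: real_distribution B unfolding B_def by (rule real_distribution_beta[OF i])
  have cont: "continuous_on UNIV (cdf \<mu>)" using assms(3) by (simp add: \<mu>_def)
  then have F [measurable]: "cdf \<mu> \<in> borel_measurable borel"
    by (rule borel_measurable_continuous_onI)
  note [measurable] = assms(7)

  let ?P = "Pi\<^sub>M {1..n} (\<lambda>_. borel :: real measure)"
  let ?vec = "\<lambda>\<omega>. \<lambda>j\<in>{1..n}. Xs j \<omega>"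
  have vec: "?vec \<in> measurable M ?P"
    using assms(5) by (intro measurable_restrict) (auto simp: indep_vars_def)
  have T_eq: "T = order_statistic n (\<lambda>j v. v j) i \<circ> ?vec"
    unfolding T_def comp_def by (intro ext order_statistic_cong) simp
  have g: "order_statistic n (\<lambda>j v. v j) i \<in> measurable ?P borel"
    by (rule measurable_order_statistic) (rule assms(10))
  have T [measurable]: "T \<in> borel_measurable M"
    unfolding T_eq using vec g by (rule measurable_comp)

  define V where "V = (\<lambda>\<omega>. cdf \<mu> (T \<omega>))"
  define U where "U = (\<lambda>\<omega>. cdf \<mu> (Xf \<omega>))"
  have indep_VU: "indep_var borel V borel U"
  proof (rule indep_var_subalgebras[OF assms(8)])
    have "?vec \<in> measurable (vimage_algebra (space M) ?vec ?P) ?P"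
      using measurable_space[OF vec] by (intro measurable_vimage_algebra1) blast
    then have "T \<in> borel_measurable (vimage_algebra (space M) ?vec ?P)"
      unfolding T_eq using g by (rule measurable_comp)
    then show "V \<in> borel_measurable (vimage_algebra (space M) ?vec ?P)"
      unfolding V_def by measurable
    have "Xf \<in> borel_measurable (vimage_algebra (space M) Xf borel)"
      by (rule measurable_vimage_algebra1) simp
    then show "U \<in> borel_measurable (vimage_algebra (space M) Xf borel)"
      unfolding U_def by measurable
  qed simp_all
  have law_V: "distr M borel V = B"
    unfolding V_def B_def T_def using assms(5,6,10) T
    by (intro distr_cdf_order_statistic \<mu>.real_distribution_axioms cont) (auto simp: T_def \<mu>_def)
  have "distr M borel U = distr (distr M borel Xf) borel (cdf \<mu>)"
    by (simp add: distr_distr U_def comp_def)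
  also have "\<dots> = uniform_measure lborel {0..1}"
    unfolding assms(9) \<mu>_def[symmetric] by (rule \<mu>.probability_integral_transform[OF cont])
  finally have law_U: "distr M borel U = uniform_measure lborel {0..1}" .

  have cont_B: "continuous_on UNIV (cdf B)"
    unfolding B_def by (rule continuous_cdf_beta[OF i])
  \<comment> \<open>Starting at \<open>-1\<close> makes \<open>0\<close> an interior point, so that \<open>H\<close> has a two-sided derivative
    on all of \<open>{0..1}\<close>.\<close>
  define H where "H x = integral {-1..x} (cdf B)" for x
  have H: "(H has_real_derivative cdf B u) (at u)" if "u \<in> {0..1}" for u
  proof -
    have "(H has_real_derivative cdf B u) (at u within {-1..2})"
      unfolding H_def using that cont_B
      by (intro integral_has_real_derivative) (auto intro: continuous_on_subset)
    then show ?thesis using that by (simp add: at_within_Icc_at)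
  qed
  let ?loss = "\<lambda>p. future_value_loss M Xf (\<lambda>\<omega>. ereal (T \<omega>)) (\<lambda>\<omega>. quantile \<mu> p)"
  \<comment> \<open>\<open>L p\<close> is \<open>\<integral>\<^sub>0\<^sup>p G u du + \<integral>\<^sub>p\<^sup>1 (1 - G u) du\<close> for the distribution function \<open>G\<close> of \<open>B\<close>.\<close>
  define L where "L p = (H p - H 0) + ((1 - H 1) - (p - H p))" for p
  have loss: "?loss p = L p" if p: "p \<in> {0..1}" for p
  proof -
    note VU = indep_VU law_U cont_B[folded law_V] H[folded law_V] p
    have "AE \<omega> in M. U \<omega> \<noteq> V \<omega> \<and> U \<omega> \<noteq> p"
      by (rule AE_indep_uniform_neq[OF VU(1-3)])
    then have "?loss p = prob {\<omega> \<in> space M. V \<omega> < U \<omega> \<and> U \<omega> < p} + prob {\<omega> \<in> space M. p < U \<omega> \<and> U \<omega> < V \<omega>}"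
      unfolding V_def U_def
      by (intro future_value_loss_eq_uniform \<mu>.real_distribution_axioms cont) auto
    also have "prob {\<omega> \<in> space M. V \<omega> < U \<omega> \<and> U \<omega> < p} = H p - H 0"
      by (intro prob_between_left VU)
    also have "prob {\<omega> \<in> space M. p < U \<omega> \<and> U \<omega> < V \<omega>} = (1 - H 1) - (p - H p)"
      by (intro prob_between_right VU)
    finally show ?thesis by (simp add: L_def)
  qed
  have L': "(L has_real_derivative (2 * cdf B p - 1)) (at p)" if "p \<in> {0..1}" for p
    unfolding L_def using that by (auto intro!: derivative_eq_intros H)
  then have cont_L: "continuous_on {a..b} L" if "{a..b} \<subseteq> {0..1}" for a b
    using that by (meson DERIV_isCont continuous_at_imp_continuous_on subsetD)

  define m where "m = median B"
  have m: "0 < m" "m < 1" "cdf B m = 1 / 2"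
    using median_beta[OF i] by (auto simp: m_def B_def)
  have L_min: "L m < L p" if p: "p \<in> {0..1}" "p \<noteq> m" for p
  proof (cases "p < m")
    case True
    show ?thesis
    proof (rule DERIV_neg_imp_decreasing_open[OF True])
      fix x assume x: "p < x" "x < m"
      then have "cdf B x < 1 / 2"
        using cdf_beta_strict_mono[OF i, of x m] p m by (simp add: B_def)
      then show "\<exists>y. (L has_real_derivative y) (at x) \<and> y < 0"
        using L'[of x] x p m by (intro exI[of _ "2 * cdf B x - 1"]) auto
    qed (use p m in \<open>auto intro: cont_L\<close>)
  next
    case False
    then have "m < p" using p by simp
    then show ?thesis
    proof (rule DERIV_pos_imp_increasing_open)
      fix x assume x: "m < x" "x < p"
      then have "1 / 2 < cdf B x"
        using cdf_beta_strict_mono[OF i, of m x] p m by (simp add: B_def)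
      then show "\<exists>y. (L has_real_derivative y) (at x) \<and> y > 0"
        using L'[of x] x p m by (intro exI[of _ "2 * cdf B x - 1"]) auto
    qed (use p m in \<open>auto intro: cont_L\<close>)
  qed
  have "is_arg_min ?loss (\<lambda>p. p \<in> {0..1}) p \<longleftrightarrow> p = m" for p
  proof
    assume *: "is_arg_min ?loss (\<lambda>p. p \<in> {0..1}) p"
    show "p = m"
      using * L_min[of p] m by (force simp: is_arg_min_def loss)
  next
    assume "p = m"
    then show "is_arg_min ?loss (\<lambda>p. p \<in> {0..1}) p"
      using L_min m by (force simp: is_arg_min_def loss)
  qed
  then show ?thesis by (simp add: m_def B_def T_def \<mu>_def)
qed

end
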